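(* Let $R=(v_1,v_2,\dots,v_n)$ be a vehicle route, where $v_1$ and $v_n$ both represent the depot, and let $$\sigma(R)=\max_{i,j\in\{1,\dots,n\}:\, i<j}\ \frac{\Delta(j)-\Delta(i)}{l_{v_j}-e_{v_i}-S_{ij}},$$ where $\Delta(i)=\sum_{m=1}^{i-1} d_{v_m,v_{m+1}}$ (with $\Delta(1)=0$) and $S_{ij}=\sum_{m=i}^{j-1}s_{v_m}$. If $\sigma(R)>0$, then the minimum (constant) speed at which the vehicle can traverse $R$ without violating any time window constraint of $R$ is equal to $\sigma(R)$. Moreover, $\sigma(R)$ can be computed in $O(n^2)$ time, where $n$ is the number of nodes in $R$.
   Context: A vehicle route $R=(v_1,\dots,v_n)$ is a fixed sequence of nodes to be visited in this order, with $v_1=v_n$ the depot and the intermediate nodes being customers. Each node $v$ has a service time $s_v\ge 0$ and a time window $[e_v,l_v]$ with $0\le e_v\le l_v<\infty$; $d_{u,v}\ge 0$ denotes the travel distance from node $u$ to node $v$. The vehicle travels at one constant speed $\nu>0$ along the whole route, so traversing the leg from $v_m$ to $v_{m+1}$ takes time $d_{v_m,v_{m+1}}/\nu$. A vehicle that arrives at a node before the window opens may wait there. A speed $\nu>0$ does not violate any time window constraint of $R$ if there exist service start times $t_1,\dots,t_n$ with $e_{v_i}\le t_i\le l_{v_i}$ for all $i=1,\dots,n$ and $t_{i+1}\ge t_i+s_{v_i}+d_{v_i,v_{i+1}}/\nu$ for all $i=1,\dots,n-1$. The quantity $\Delta(i)$ is the total distance from the depot to the $i$-th node along $R$, and $S_{ij}$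 is the total service time from node $v_i$ to node $v_{j-1}$ along $R$. All denominators in the definition of $\sigma(R)$ are understood to be nonzero, so that $\sigma(R)$ is defined. Complexity is counted in elementary arithmetic operations and comparisons on real numbers.
   Formalization: The minimum-speed claim additionally assumes that at least one speed violates no time window of R; without this it fails, since service times alone can make R infeasible at every speed while σ(R)>0. *)

theory Defs
  imports Complex_Main "HOL-Library.Landau_Symbols"
begin

section \<open>Vehicle routes with time windows\<close>

record 'v vrp_data =
  depot :: 'v
  service :: "'v \<Rightarrow> real"
  earliest :: "'v \<Rightarrow> real"
  latest :: "'v \<Rightarrow> real"
  distance :: "'v \<Rightarrow> 'v \<Rightarrow> real"

text \<open>Positions on a route are counted from 1, whereas \<open>(!)\<close> counts from 0.\<close>

definition stop :: "'v list \<Rightarrow> nat \<Rightarrow> 'v" where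
  "stop R i = R ! (i - 1)"

definition vehicle_route :: "'v vrp_data \<Rightarrow> 'v list \<Rightarrow> bool" where
  "vehicle_route I R \<longleftrightarrow>
     length R \<ge> 2 \<and>
     stop R 1 = depot I \<and> stop R (length R) = depot I \<and>
     (\<forall>i. 1 < i \<and> i < length R \<longrightarrow> stop R i \<noteq> depot I) \<and>
     (\<forall>v\<in>set R. 0 \<le> service I v \<and> 0 \<le> earliest I v \<and> earliest I v \<le> latest I v) \<and>
     (\<forall>u\<in>set R. \<forall>v\<in>set R. 0 \<le> distance I u v)"

definition admissible_speed :: "'v vrp_data \<Rightarrow> 'v list \<Rightarrow> real \<Rightarrow> bool" where
  "admissible_speed I R \<nu> \<longleftrightarrow>
     0 < \<nu> \<and>
     (\<exists>t :: nat \<Rightarrow> real.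
        (\<forall>i\<in>{1..length R}. earliest I (stop R i) \<le> t i \<and> t i \<le> latest I (stop R i)) \<and>
        (\<forall>i\<in>{1..<length R}.
           t (i + 1) \<ge> t i + service I (stop R i)
                          + distance I (stop R i) (stop R (i + 1)) / \<nu>))"

definition minimum_speed :: "'v vrp_data \<Rightarrow> 'v list \<Rightarrow> real \<Rightarrow> bool" where
  "minimum_speed I R \<nu> \<longleftrightarrow>
     admissible_speed I R \<nu> \<and> (\<forall>\<mu>. admissible_speed I R \<mu> \<longrightarrow> \<nu> \<le> \<mu>)"

definition Delta :: "'v vrp_data \<Rightarrow> 'v list \<Rightarrow> nat \<Rightarrow> real" where
  "Delta I R i = (\<Sum>m\<in>{1..<i}. distance I (stop R m) (stop R (m + 1)))"

definition total_service :: "'v vrp_data \<Rightarrow> 'v list \<Rightarrow> nat \<Rightarrow> nat \<Rightarrow> real" where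
  "total_service I R i j = (\<Sum>m\<in>{i..<j}. service I (stop R m))"

definition slack :: "'v vrp_data \<Rightarrow> 'v list \<Rightarrow> nat \<Rightarrow> nat \<Rightarrow> real" where
  "slack I R i j = latest I (stop R j) - earliest I (stop R i) - total_service I R i j"

definition sigma_defined :: "'v vrp_data \<Rightarrow> 'v list \<Rightarrow> bool" where
  "sigma_defined I R \<longleftrightarrow> (\<forall>i j. 1 \<le> i \<and> i < j \<and> j \<le> length R \<longrightarrow> slack I R i j \<noteq> 0)"

definition sigma :: "'v vrp_data \<Rightarrow> 'v list \<Rightarrow> real" where
  "sigma I R = Max {(Delta I R j - Delta I R i) / slack I R i j | i j.
                      1 \<le> i \<and> i < j \<and> j \<le> length R}"


section \<open>Real random access programs\<close>

text \<open>
  A small imperative language over the reals, used to state running times. A store has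
  natural-number variables (used for indexing), real variables and real arrays. Real numbers
  can be combined only by the four arithmetic operations and inspected only by comparisons;
  no operation converts a real number to an index. Every
  assignment, array access and test costs one unit, so the cost bounds in particular the
  number of arithmetic operations and comparisons on real numbers.
\<close>

record store =
  ivar :: "string \<Rightarrow> nat"
  rvar :: "string \<Rightarrow> real"
  arr :: "string \<Rightarrow> nat \<Rightarrow> real"

datatype arith_op = Plus | Minus | Times | Divide

fun arith :: "arith_op \<Rightarrow> real \<Rightarrow> real \<Rightarrow> real" where
  "arith Plus a b = a + b"
| "arith Minus a b = a - b"
| "arith Times a b = a * b"
| "arith Divide a b = a / b"

datatype test =
    ILess string string
  | RLess string string

fun holds :: "test \<Rightarrow> store \<Rightarrow> bool" where
  "holds (ILess x y) s \<longleftrightarrow> ivar s x < ivar s y"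
| "holds (RLess x y) s \<longleftrightarrow> rvar s x < rvar s y"

datatype com =
    Skip
  | IConst string nat
  | IAdd string string string
  | ISub string string string
  | RConst string rat
  | RArith arith_op string string string
  | Load string string string
  | Store string string string
  | Seq com com
  | Cond test com com
  | While test com

text \<open>
  \<open>exec c s k s'\<close>: started in store \<open>s\<close>, the program \<open>c\<close> terminates in store \<open>s'\<close> at cost \<open>k\<close>.
  Division by zero has no rule, so a program that attempts it has no execution.
\<close>

inductive exec :: "com \<Rightarrow> store \<Rightarrow> nat \<Rightarrow> store \<Rightarrow> bool" where
  Skip: "exec Skip s 0 s"
| IConst: "exec (IConst x k) s 1 (s\<lparr>ivar := (ivar s)(x := k)\<rparr>)"
| IAdd: "exec (IAdd x y z) s 1 (s\<lparr>ivar := (ivar s)(x := ivar s y + ivar s z)\<rparr>)"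
| ISub: "exec (ISub x y z) s 1 (s\<lparr>ivar := (ivar s)(x := ivar s y - ivar s z)\<rparr>)"
| RConst: "exec (RConst x q) s 1 (s\<lparr>rvar := (rvar s)(x := of_rat q)\<rparr>)"
| RArith: "(f = Divide \<Longrightarrow> rvar s z \<noteq> 0) \<Longrightarrow>
    exec (RArith f x y z) s 1 (s\<lparr>rvar := (rvar s)(x := arith f (rvar s y) (rvar s z))\<rparr>)"
| Load: "exec (Load x a i) s 1 (s\<lparr>rvar := (rvar s)(x := arr s a (ivar s i))\<rparr>)"
| Store: "exec (Store a i x) s 1
    (s\<lparr>arr := (arr s)(a := (arr s a)(ivar s i := rvar s x))\<rparr>)"
| Seq: "exec c1 s k1 s' \<Longrightarrow> exec c2 s' k2 s'' \<Longrightarrow> exec (Seq c1 c2) s (k1 + k2) s''"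
| CondTrue: "holds b s \<Longrightarrow> exec c1 s k s' \<Longrightarrow> exec (Cond b c1 c2) s (k + 1) s'"
| CondFalse: "\<not> holds b s \<Longrightarrow> exec c2 s k s' \<Longrightarrow> exec (Cond b c1 c2) s (k + 1) s'"
| WhileFalse: "\<not> holds b s \<Longrightarrow> exec (While b c) s 1 s"
| WhileTrue: "holds b s \<Longrightarrow> exec c s k1 s' \<Longrightarrow> exec (While b c) s' k2 s'' \<Longrightarrow>
    exec (While b c) s (k1 + k2 + 1) s''"

inductive_cases SkipE: "exec Skip s k s'"
  and IConstE: "exec (IConst x q) s k s'"
  and IAddE: "exec (IAdd x y z) s k s'"
  and ISubE: "exec (ISub x y z) s k s'"
  and RConstE: "exec (RConst x q) s k s'"
  and RArithE: "exec (RArith f x y z) s k s'"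
  and LoadE: "exec (Load x a i) s k s'"
  and StoreE: "exec (Store a i x) s k s'"
  and SeqE: "exec (Seq c1 c2) s k s'"
  and CondE: "exec (Cond b c1 c2) s k s'"
  and WhileE: "exec (While b c) s k s'"

lemma exec_deterministic:
  assumes "exec c s k s'" "exec c s l s''"
  shows "k = l \<and> s' = s''"
  using assms
proof (induction arbitrary: l s'' rule: exec.induct)
  case (Seq c1 s k1 s1 c2 k2 s2)
  from Seq.prems show ?case
    by (rule SeqE) (metis Seq.IH)
next
  case (CondTrue b s c1 k s1 c2)
  from CondTrue.prems show ?case
    by (rule CondE) (use CondTrue.IH CondTrue.hyps in \<open>fastforce+\<close>)
next
  case (CondFalse b s c2 k s1 c1)
  from CondFalse.prems show ?case
    by (rule CondE) (use CondFalse.IH CondFalse.hyps in \<open>fastforce+\<close>)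
next
  case (WhileFalse b s c)
  from WhileFalse.prems show ?case
    by (rule WhileE) (use WhileFalse.hyps in \<open>simp_all\<close>)
next
  case (WhileTrue b s c k1 s1 k2 s2)
  from WhileTrue.prems show ?case
    by (rule WhileE) (use WhileTrue.IH WhileTrue.hyps in \<open>fastforce+\<close>)
qed (erule SkipE IConstE IAddE ISubE RConstE RArithE LoadE StoreE, simp)+

text \<open>
  The input of a route computation: the number of nodes and, by position on the route, the
  windows, the service times and the lengths of the legs. All else is initialised with 0.
\<close>

definition route_input :: "'v vrp_data \<Rightarrow> 'v list \<Rightarrow> store" where
  "route_input I R =
     \<lparr>ivar = (\<lambda>_. 0)(''n'' := length R),
      rvar = (\<lambda>_. 0),
      arr = (\<lambda>_ _. 0)
        (''e'' := \<lambda>i. if i \<in> {1..length R} then earliest I (stop R i) else 0,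
         ''l'' := \<lambda>i. if i \<in> {1..length R} then latest I (stop R i) else 0,
         ''s'' := \<lambda>i. if i \<in> {1..length R} then service I (stop R i) else 0,
         ''d'' := \<lambda>i. if i \<in> {1..<length R}
                      then distance I (stop R i) (stop R (i + 1)) else 0)\<rparr>"

definition computes_sigma :: "com \<Rightarrow> 'v vrp_data \<Rightarrow> 'v list \<Rightarrow> nat \<Rightarrow> bool" where
  "computes_sigma c I R k \<longleftrightarrow>
     (\<exists>s'. exec c (route_input I R) k s' \<and> rvar s' ''result'' = sigma I R)"

end

theory Submission
  imports Defs
begin

text \<open>
  Serving every node as early as possible at speed \<open>\<nu>\<close> starts the service at position \<open>j\<close> at
  the maximum over \<open>i \<le> j\<close> of the opening time of \<open>i\<close> plus the service and travel times
  from \<open>i\<close> to \<open>j\<close>. So \<open>\<nu>\<close> is admissible iff each of these terms is at most the closing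
  time of \<open>j\<close>. Once all slacks are positive this reads: \<open>\<nu>\<close> is at least every quotient in the
  definition of \<open>\<sigma>(R)\<close>. The slacks, being nonzero, are positive as soon as some speed is
  admissible. For the running time, the partial sums \<open>\<Delta>(j) - \<Delta>(i)\<close> and \<open>S\<^sub>i\<^sub>j\<close> are updated
  in constant time when \<open>j\<close> is increased.
\<close>

section \<open>The minimum speed\<close>

definition speed_bound :: "'v vrp_data \<Rightarrow> 'v list \<Rightarrow> nat \<Rightarrow> nat \<Rightarrow> real" where
  "speed_bound I R i j = (Delta I R j - Delta I R i) / slack I R i j"

definition speed_bounds :: "'v vrp_data \<Rightarrow> 'v list \<Rightarrow> real set" where
  "speed_bounds I R = {speed_bound I R i j | i j. 1 \<le> i \<and> i < j \<and> j \<le> length R}"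

lemma sigma_eq_Max: "sigma I R = Max (speed_bounds I R)"
  by (simp add: sigma_def speed_bounds_def speed_bound_def)

lemma finite_speed_bounds: "finite (speed_bounds I R)"
proof (rule finite_subset)
  show "speed_bounds I R \<subseteq> (\<lambda>(i, j). speed_bound I R i j) ` ({..length R} \<times> {..length R})"
    unfolding speed_bounds_def by force
qed simp

lemma speed_bound_in_bounds:
  "\<lbrakk>1 \<le> i; i < j; j \<le> length R\<rbrakk> \<Longrightarrow> speed_bound I R i j \<in> speed_bounds I R"
  unfolding speed_bounds_def by blast

lemma speed_bound_le_sigma:
  "\<lbrakk>1 \<le> i; i < j; j \<le> length R\<rbrakk> \<Longrightarrow> speed_bound I R i j \<le> sigma I R"
  by (simp add: sigma_eq_Max Max_ge[OF finite_speed_bounds speed_bound_in_bounds])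

lemma sigma_in_speed_bounds:
  assumes "length R \<ge> 2"
  shows "sigma I R \<in> speed_bounds I R"
  unfolding sigma_eq_Max
proof (rule Max_in[OF finite_speed_bounds])
  show "speed_bounds I R \<noteq> {}"
    using speed_bound_in_bounds[of 1 2 R I] assms by auto
qed

lemma stop_in_set: "\<lbrakk>1 \<le> i; i \<le> length R\<rbrakk> \<Longrightarrow> stop R i \<in> set R"
  by (simp add: stop_def)

lemma Delta_Suc:
  "1 \<le> i \<Longrightarrow> Delta I R (Suc i) = Delta I R i + distance I (stop R i) (stop R (i + 1))"
  by (simp add: Delta_def)

lemma total_service_same [simp]: "total_service I R i i = 0"
  by (simp add: total_service_def)

lemma total_service_Suc:
  "i \<le> j \<Longrightarrow> total_service I R i (Suc j) = total_service I R i j + service I (stop R j)"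
  by (simp add: total_service_def)

lemma Delta_mono:
  assumes "vehicle_route I R" "1 \<le> i" "i \<le> j" "j \<le> length R"
  shows "Delta I R i \<le> Delta I R j"
  using assms(3,4)
proof (induction j rule: dec_induct)
  case (step j)
  have "0 \<le> distance I (stop R j) (stop R (j + 1))"
    using assms(1,2) step by (simp add: vehicle_route_def stop_in_set)
  then show ?case
    using step assms(2) by (simp add: Delta_Suc)
qed simp

text \<open>Adding up the leg inequalities from \<open>i\<close> to \<open>j\<close> telescopes;
  waiting can only increase the left-hand side.\<close>

lemma service_start_lower_bound:
  assumes "\<And>m. m \<in> {1..<length R} \<Longrightarrow>
      t (m + 1) \<ge> t m + service I (stop R m) + distance I (stop R m) (stop R (m + 1)) / \<nu>"
    and "1 \<le> i" "i \<le> j" "j \<le> length R"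
  shows "t j \<ge> t i + total_service I R i j + (Delta I R j - Delta I R i) / \<nu>"
  using assms(3,4)
proof (induction j rule: dec_induct)
  case (step j)
  then show ?case
    using assms(1)[of j] assms(2)
    by (simp add: Delta_Suc total_service_Suc add_divide_distrib diff_divide_distrib)
qed simp

text \<open>Necessity: service at \<open>i\<close> starts no earlier than its window opens and at
  \<open>j\<close> no later than its window closes, so travelling must fit into the slack.\<close>

lemma admissible_speed_slack:
  assumes "admissible_speed I R \<nu>" "1 \<le> i" "i \<le> j" "j \<le> length R"
  shows "(Delta I R j - Delta I R i) / \<nu> \<le> slack I R i j"
proof -
  obtain t where
    window: "\<And>m. m \<in> {1..length R} \<Longrightarrow>
        earliest I (stop R m) \<le> t m \<and> t m \<le> latest I (stop R m)"
    and leg: "\<And>m. m \<in> {1..<length R} \<Longrightarrow>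
        t (m + 1) \<ge> t m + service I (stop R m) + distance I (stop R m) (stop R (m + 1)) / \<nu>"
    using assms(1) unfolding admissible_speed_def by blast
  show ?thesis
    using service_start_lower_bound[of R t I \<nu>, OF leg assms(2-4)] window[of i] window[of j] assms(2-4)
    by (simp add: slack_def)
qed

text \<open>Sufficiency, by the earliest schedule. The premise includes \<open>i = j\<close>, where
  it says that the window of \<open>i\<close> is nonempty.\<close>

lemma admissible_speedI:
  assumes "\<nu> > 0"
    and feasible: "\<And>i j. \<lbrakk>1 \<le> i; i \<le> j; j \<le> length R\<rbrakk> \<Longrightarrow>
      (Delta I R j - Delta I R i) / \<nu> \<le> slack I R i j"
  shows "admissible_speed I R \<nu>"
proof -
  \<comment> \<open>The start time at \<open>j\<close> if service at \<open>i\<close> begins when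
    its window opens and there is no waiting afterwards.\<close>
  define reach where "reach i j =
    earliest I (stop R i) + total_service I R i j + (Delta I R j - Delta I R i) / \<nu>" for i j
  define t where "t j = Max ((\<lambda>i. reach i j) ` {1..j})" for j
  have reach_le: "reach i j \<le> t j" if "1 \<le> i" "i \<le> j" for i j
    unfolding t_def using that by (intro Max_ge) auto
  have attained: "\<exists>i. 1 \<le> i \<and> i \<le> j \<and> t j = reach i j" if "1 \<le> j" for j
    using Max_in[of "(\<lambda>i. reach i j) ` {1..j}"] that unfolding t_def by fastforce
  have "earliest I (stop R j) \<le> t j \<and> t j \<le> latest I (stop R j)" if j: "j \<in> {1..length R}" for j
  proof
    show "earliest I (stop R j) \<le> t j"
      using reach_le[of j j] j by (simp add: reach_def)
    obtain i where "1 \<le> i" "i \<le> j" "t j = reach i j"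
      using attained[of j] j by auto
    then show "t j \<le> latest I (stop R j)"
      using feasible[of i j] j by (simp add: reach_def slack_def)
  qed
  moreover have "t j + service I (stop R j) + distance I (stop R j) (stop R (j + 1)) / \<nu> \<le> t (j + 1)"
    if j: "j \<in> {1..<length R}" for j
  proof -
    \<comment> \<open>Extending the maximising term for \<open>j\<close> by one leg gives one of the
      terms in the maximum for \<open>j + 1\<close>.\<close>
    obtain i where i: "1 \<le> i" "i \<le> j" "t j = reach i j"
      using attained[of j] j by auto
    have "reach i (j + 1) =
        reach i j + service I (stop R j) + distance I (stop R j) (stop R (j + 1)) / \<nu>"
      using i j
      by (simp add: reach_def Delta_Suc total_service_Suc add_divide_distrib diff_divide_distrib)
    then show ?thesis
      using reach_le[of i "j + 1"] i by simp
  qed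
  ultimately show ?thesis
    unfolding admissible_speed_def using assms(1) by blast
qed

text \<open>The given speed \<open>\<nu>\<close> serves to fix the sign of the slacks. A negative
  slack rules out every speed, yet its quotient is at most 0 and would go unnoticed in a positive
  maximum.\<close>

lemma minimum_speed_sigma:
  assumes route: "vehicle_route I R" and defined: "sigma_defined I R"
    and admissible: "admissible_speed I R \<nu>" and pos: "sigma I R > 0"
  shows "minimum_speed I R (sigma I R)"
proof -
  have slack_pos: "slack I R i j > 0" if "1 \<le> i" "i < j" "j \<le> length R" for i j
  proof -
    have "0 \<le> (Delta I R j - Delta I R i) / \<nu>"
      using Delta_mono[OF route, of i j] admissible that by (simp add: admissible_speed_def)
    also have "\<dots> \<le> slack I R i j"
      using admissible_speed_slack[OF admissible] that by simp
    finally show ?thesis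
      using defined that by (simp add: sigma_defined_def order_less_le)
  qed
  have "admissible_speed I R (sigma I R)"
  proof (rule admissible_speedI[OF pos])
    fix i j assume ij: "1 \<le> i" "i \<le> j" "j \<le> length R"
    show "(Delta I R j - Delta I R i) / sigma I R \<le> slack I R i j"
    proof (cases "i = j")
      case True
      then show ?thesis
        using route ij by (simp add: slack_def vehicle_route_def stop_in_set)
    next
      case False
      then show ?thesis
        \<comment> \<open>Slack and speed are both positive, so they may trade places as
          divisors.\<close>
        using speed_bound_le_sigma[of i j R I] slack_pos[of i j] pos ij
        by (simp add: speed_bound_def divide_le_eq mult.commute)
    qed
  qed
  moreover have "sigma I R \<le> \<mu>" if \<mu>: "admissible_speed I R \<mu>" for \<mu>
  proof -
    \<comment> \<open>The maximum is attained at some pair, and that pair alone forces every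
      admissible \<open>\<mu>\<close> up to it.\<close>
    have "2 \<le> length R"
      using route by (simp add: vehicle_route_def)
    then obtain i j where ij: "1 \<le> i" "i < j" "j \<le> length R"
      and eq: "sigma I R = speed_bound I R i j"
      using sigma_in_speed_bounds[of R I] unfolding speed_bounds_def by blast
    then show ?thesis
      using admissible_speed_slack[OF \<mu>, of i j] slack_pos[of i j] \<mu>
      by (simp add: speed_bound_def admissible_speed_def divide_le_eq mult.commute)
  qed
  ultimately show ?thesis
    by (simp add: minimum_speed_def)
qed

section \<open>Weakest preconditions with costs\<close>

text \<open>Total correctness: an execution must exist, so a proof of \<open>wp\<close> also shows
  termination and the absence of division by zero.\<close>

definition wp :: "com \<Rightarrow> store \<Rightarrow> (nat \<Rightarrow> store \<Rightarrow> bool) \<Rightarrow> bool" where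
  "wp c s Q \<longleftrightarrow> (\<exists>k s'. exec c s k s' \<and> Q k s')"

lemma wp_mono: "\<lbrakk>wp c s P; \<And>k s'. P k s' \<Longrightarrow> Q k s'\<rbrakk> \<Longrightarrow> wp c s Q"
  unfolding wp_def by blast

lemma exec_basic_iff:
  "exec Skip s k' s' \<longleftrightarrow> k' = 0 \<and> s' = s"
  "exec (IConst x k) s k' s' \<longleftrightarrow> k' = 1 \<and> s' = s\<lparr>ivar := (ivar s)(x := k)\<rparr>"
  "exec (IAdd x y z) s k' s' \<longleftrightarrow>
     k' = 1 \<and> s' = s\<lparr>ivar := (ivar s)(x := ivar s y + ivar s z)\<rparr>"
  "exec (RConst x q) s k' s' \<longleftrightarrow> k' = 1 \<and> s' = s\<lparr>rvar := (rvar s)(x := of_rat q)\<rparr>"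
  "exec (RArith f x y z) s k' s' \<longleftrightarrow> (f = Divide \<longrightarrow> rvar s z \<noteq> 0) \<and>
     k' = 1 \<and> s' = s\<lparr>rvar := (rvar s)(x := arith f (rvar s y) (rvar s z))\<rparr>"
  "exec (Load x a i) s k' s' \<longleftrightarrow>
     k' = 1 \<and> s' = s\<lparr>rvar := (rvar s)(x := arr s a (ivar s i))\<rparr>"
  by (auto intro: exec.intros[simplified] elim!: SkipE IConstE IAddE RConstE RArithE LoadE)

lemma wp_basic [simp]:
  "wp Skip s Q \<longleftrightarrow> Q 0 s"
  "wp (IConst x k) s Q \<longleftrightarrow> Q 1 (s\<lparr>ivar := (ivar s)(x := k)\<rparr>)"
  "wp (IAdd x y z) s Q \<longleftrightarrow> Q 1 (s\<lparr>ivar := (ivar s)(x := ivar s y + ivar s z)\<rparr>)"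
  "wp (RConst x q) s Q \<longleftrightarrow> Q 1 (s\<lparr>rvar := (rvar s)(x := of_rat q)\<rparr>)"
  "wp (RArith f x y z) s Q \<longleftrightarrow> (f = Divide \<longrightarrow> rvar s z \<noteq> 0) \<and>
     Q 1 (s\<lparr>rvar := (rvar s)(x := arith f (rvar s y) (rvar s z))\<rparr>)"
  "wp (Load x a i) s Q \<longleftrightarrow> Q 1 (s\<lparr>rvar := (rvar s)(x := arr s a (ivar s i))\<rparr>)"
  by (auto simp: wp_def exec_basic_iff)

lemma wp_Seq [simp]:
  "wp (Seq c1 c2) s Q \<longleftrightarrow> wp c1 s (\<lambda>k1 s1. wp c2 s1 (\<lambda>k2. Q (k1 + k2)))"
  unfolding wp_def by (blast intro: exec.Seq elim: SeqE)

lemma wp_Cond [simp]: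
  "wp (Cond b c1 c2) s Q \<longleftrightarrow> wp (if holds b s then c1 else c2) s (\<lambda>k. Q (k + 1))"
  unfolding wp_def
  by (cases "holds b s")
     (auto intro: exec.CondTrue[simplified] exec.CondFalse[simplified] elim!: CondE)

text \<open>Indexing the invariant by a counter yields termination and cost together:
  \<open>N - m\<close> rounds of at most \<open>K\<close> plus one test each, and one final failing
  test.\<close>

lemma wp_While_counter:
  assumes "J m s" "m \<le> N"
    and step: "\<And>m s. \<lbrakk>m < N; J m s\<rbrakk> \<Longrightarrow> holds b s \<and> wp c s (\<lambda>k s'. k \<le> K \<and> J (Suc m) s')"
    and exit: "\<And>s. J N s \<Longrightarrow> \<not> holds b s"
  shows "wp (While b c) s (\<lambda>k s'. k \<le> (N - m) * (K + 1) + 1 \<and> J N s')"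
  using assms(2,1)
proof (induction m arbitrary: s rule: inc_induct)
  case base
  then show ?case
    using exec.WhileFalse[OF exit[OF base]] unfolding wp_def
    by (intro exI[of _ 1] exI[of _ s]) simp
next
  case (step m)
  obtain k1 s1 where 1: "holds b s" "exec c s k1 s1" "k1 \<le> K" "J (Suc m) s1"
    using assms(3)[OF step.hyps(2) step.prems] unfolding wp_def by blast
  obtain k2 s2 where 2: "exec (While b c) s1 k2 s2" "k2 \<le> (N - Suc m) * (K + 1) + 1" "J N s2"
    using step.IH[OF 1(4)] unfolding wp_def by blast
  have "N - m = Suc (N - Suc m)"
    using step.hyps(2) by simp
  then have "k1 + k2 + 1 \<le> (N - m) * (K + 1) + 1"
    using 1(3) 2(2) by simp
  then show ?case
    unfolding wp_def using exec.WhileTrue[OF 1(1,2) 2(1)] 2(3) by blast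
qed

section \<open>Computing the maximum in quadratic time\<close>

fun seq :: "com list \<Rightarrow> com" where
  "seq [] = Skip"
| "seq (c # cs) = Seq c (seq cs)"

text \<open>The leg and the service time are read at the old \<open>j\<close>, the closing time at
  the new one. Adding \<open>''zero''\<close>, which is never assigned and keeps its initial value
  0, replaces a copy instruction.\<close>

definition inner_body :: com where
  "inner_body = seq
    [Load ''d'' ''d'' ''j'', RArith Plus ''D'' ''D'' ''d'',
     Load ''s'' ''s'' ''j'', RArith Plus ''S'' ''S'' ''s'',
     IAdd ''j'' ''j'' ''one'',
     Load ''l'' ''l'' ''j'', RArith Minus ''a'' ''l'' ''e'', RArith Minus ''a'' ''a'' ''S'',
     RArith Divide ''q'' ''D'' ''a'',
     Cond (RLess ''result'' ''q'') (RArith Plus ''result'' ''q'' ''zero'') Skip]"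

definition outer_body :: com where
  "outer_body = seq
    [Load ''e'' ''e'' ''i'', RConst ''D'' 0, RConst ''S'' 0, IAdd ''j'' ''i'' ''zero'',
     While (ILess ''j'' ''n'') inner_body,
     IAdd ''i'' ''i'' ''one'']"

text \<open>
  The result cannot be initialised with 0, since all quotients may be negative; the program
  starts from the quotient for the pair (1, 2).
\<close>

definition sigma_program :: com where
  "sigma_program = seq
    [IConst ''one'' 1, IConst ''i'' 1, IConst ''j'' 2,
     Load ''d'' ''d'' ''i'', Load ''l'' ''l'' ''j'', Load ''e'' ''e'' ''i'', Load ''s'' ''s'' ''i'',
     RArith Minus ''a'' ''l'' ''e'', RArith Minus ''a'' ''a'' ''s'',
     RArith Divide ''result'' ''d'' ''a'',
     While (ILess ''i'' ''n'') outer_body]"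

text \<open>Membership in \<open>speed_bounds\<close> keeps the result from exceeding the maximum;
  the last conjunct bounds it from below by all rows before \<open>i\<close>.\<close>

definition outer_inv :: "'v vrp_data \<Rightarrow> 'v list \<Rightarrow> nat \<Rightarrow> store \<Rightarrow> bool" where
  "outer_inv I R i s \<longleftrightarrow>
     1 \<le> i \<and> arr s = arr (route_input I R) \<and>
     ivar s ''n'' = length R \<and> ivar s ''one'' = 1 \<and> ivar s ''zero'' = 0 \<and> ivar s ''i'' = i \<and>
     rvar s ''zero'' = 0 \<and>
     rvar s ''result'' \<in> speed_bounds I R \<and>
     (\<forall>i' j'. 1 \<le> i' \<and> i' < i \<and> i' < j' \<and> j' \<le> length R \<longrightarrow>
        speed_bound I R i' j' \<le> rvar s ''result'')"

definition inner_inv :: "'v vrp_data \<Rightarrow> 'v list \<Rightarrow> nat \<Rightarrow> nat \<Rightarrow> store \<Rightarrow> bool" where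
  "inner_inv I R i j s \<longleftrightarrow>
     outer_inv I R i s \<and> i \<le> j \<and> ivar s ''j'' = j \<and>
     rvar s ''e'' = earliest I (stop R i) \<and>
     rvar s ''D'' = Delta I R j - Delta I R i \<and>
     rvar s ''S'' = total_service I R i j \<and>
     (\<forall>j'. i < j' \<and> j' \<le> j \<longrightarrow> speed_bound I R i j' \<le> rvar s ''result'')"

lemma route_input_simps [simp]:
  "i \<in> {1..length R} \<Longrightarrow> arr (route_input I R) ''e'' i = earliest I (stop R i)"
  "i \<in> {1..length R} \<Longrightarrow> arr (route_input I R) ''l'' i = latest I (stop R i)"
  "i \<in> {1..length R} \<Longrightarrow> arr (route_input I R) ''s'' i = service I (stop R i)"
  "i \<in> {1..<length R} \<Longrightarrow>
     arr (route_input I R) ''d'' i = distance I (stop R i) (stop R (Suc i))"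
  "ivar (route_input I R) = (\<lambda>_. 0)(''n'' := length R)"
  "rvar (route_input I R) = (\<lambda>_. 0)"
  by (simp_all add: route_input_def)

text \<open>The cost 11 is nine assignments and loads, one comparison and at most one update of the
  result.\<close>

lemma wp_inner_body:
  assumes "sigma_defined I R" "j < length R" "inner_inv I R i j s"
  shows "wp inner_body s (\<lambda>k s'. k \<le> 11 \<and> inner_inv I R i (Suc j) s')"
proof -
  have ij: "1 \<le> i" "i \<le> j"
    using assms(3) by (auto simp: inner_inv_def outer_inv_def)
  then have slack: "slack I R i (Suc j) \<noteq> 0"
    using assms(1,2) by (simp add: sigma_defined_def)
  have sums:
    "rvar s ''D'' + distance I (stop R j) (stop R (Suc j)) = Delta I R (Suc j) - Delta I R i"
    "rvar s ''S'' + service I (stop R j) = total_service I R i (Suc j)"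
    using assms(3) ij by (simp_all add: inner_inv_def Delta_Suc total_service_Suc)
  have denom:
    "latest I (stop R (Suc j)) - rvar s ''e'' - total_service I R i (Suc j) = slack I R i (Suc j)"
    using assms(3) by (simp add: inner_inv_def slack_def)
  then have nz: "latest I (stop R (Suc j)) - rvar s ''e'' \<noteq> total_service I R i (Suc j)"
    using slack by auto
  have mem: "speed_bound I R i (Suc j) \<in> speed_bounds I R"
    using ij assms(2) by (intro speed_bound_in_bounds) auto
  have vars: "arr s = arr (route_input I R)" "ivar s ''j'' = j" "ivar s ''one'' = 1"
    "rvar s ''zero'' = 0"
    using assms(3) by (auto simp: inner_inv_def outer_inv_def)
  show ?thesis
    using assms ij slack nz mem
    apply (simp add: inner_body_def vars sums denom flip: speed_bound_def)
    \<comment> \<open>If the new quotient is larger, the earlier bounds pass to it by transitivity;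
      otherwise the old result already dominates it.\<close>
    apply (intro conjI impI)
    subgoal
      by (auto simp: inner_inv_def outer_inv_def le_Suc_eq intro: order_trans[OF _ less_imp_le])
    subgoal
      by (auto simp: inner_inv_def outer_inv_def le_Suc_eq)
    done
qed

text \<open>Five basic commands plus at most \<open>12 * (length R - i) + 1\<close> for the inner
  loop.\<close>

lemma wp_outer_body:
  assumes "sigma_defined I R" "i < length R" "outer_inv I R i s"
  shows "wp outer_body s (\<lambda>k s'. k \<le> 12 * length R + 6 \<and> outer_inv I R (Suc i) s')"
proof -
  have loop: "wp (While (ILess ''j'' ''n'') inner_body) s'
      (\<lambda>k s''. k \<le> (length R - i) * (11 + 1) + 1 \<and> inner_inv I R i (length R) s'')"
    if "inner_inv I R i i s'" for s'
    using that assms(2) wp_inner_body[OF assms(1)]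
    by (intro wp_While_counter) (auto simp: inner_inv_def outer_inv_def)
  show ?thesis
    using assms(2,3)
    apply (simp add: outer_body_def)
    apply (rule wp_mono[OF loop])
     apply (auto simp: inner_inv_def outer_inv_def less_Suc_eq)
    done
qed

lemma wp_sigma_program:
  assumes "vehicle_route I R" "sigma_defined I R"
  shows "wp sigma_program (route_input I R)
    (\<lambda>k s. k \<le> length R * (12 * length R + 7) + 11 \<and> rvar s ''result'' = sigma I R)"
proof -
  have len: "2 \<le> length R"
    using assms(1) by (simp add: vehicle_route_def)
  \<comment> \<open>The loop stops at \<open>i = length R\<close>, since no pair starts at the last
    position; hence \<open>length R - 1\<close> rounds.\<close>
  have loop: "wp (While (ILess ''i'' ''n'') outer_body) s
      (\<lambda>k s'. k \<le> (length R - 1) * (12 * length R + 6 + 1) + 1 \<and> outer_inv I R (length R) s')"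
    if "outer_inv I R 1 s" for s
    using that len wp_outer_body[OF assms(2)]
    by (intro wp_While_counter) (auto simp: outer_inv_def)
  have slack: "latest I (stop R 2) - earliest I (stop R 1) - service I (stop R 1) = slack I R 1 2"
    by (simp add: slack_def total_service_def numeral_2_eq_2)
  have bound: "distance I (stop R 1) (stop R (Suc 1)) / slack I R 1 2 = speed_bound I R 1 2"
    by (simp add: speed_bound_def Delta_def numeral_2_eq_2)
  have nz: "slack I R 1 2 \<noteq> 0"
    using assms(2) len by (simp add: sigma_defined_def)
  \<comment> \<open>This makes the initial result satisfy \<open>outer_inv\<close> at 1, where no
    rows have been processed yet.\<close>
  have mem: "speed_bound I R 1 2 \<in> speed_bounds I R"
    using len by (intro speed_bound_in_bounds) auto
  have final: "rvar s ''result'' = sigma I R" if "outer_inv I R (length R) s" for s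
    unfolding sigma_eq_Max using that
    by (intro Max_eqI[symmetric] finite_speed_bounds)
       (auto simp: outer_inv_def speed_bounds_def)
  \<comment> \<open>The ten initial commands and the final loop test give the additive 11 of the
    total.\<close>
  have cost: "(length R - 1) * (12 * length R + 6 + 1) + 1 \<le> Suc (length R * (12 * length R + 7))"
    using mult_le_mono[of "length R - 1" "length R" "12 * length R + 6 + 1" "12 * length R + 7"]
    by simp
  show ?thesis
    using len nz mem slack bound
    apply (simp add: sigma_program_def)
    apply (rule wp_mono[OF loop])
    subgoal by (simp add: outer_inv_def)
    subgoal using final order_trans[OF _ cost] by blast
    done
qed

theorem proposition1:
  shows "(\<forall>(I :: 'v vrp_data) R.
            vehicle_route I R \<and> sigma_defined I R \<and> (\<exists>\<nu>. admissible_speed I R \<nu>) \<and>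
            sigma I R > 0 \<longrightarrow> minimum_speed I R (sigma I R)) \<and>
         (\<exists>c (T :: nat \<Rightarrow> real).
            T \<in> O(\<lambda>n. real n ^ 2) \<and>
            (\<forall>(I :: 'v vrp_data) R.
               vehicle_route I R \<and> sigma_defined I R \<longrightarrow>
               (\<exists>k. computes_sigma c I R k \<and> real k \<le> T (length R))))"
\<comment> \<open>The constant is 30 = 12 + 7 + 11, as both 1 and \<open>n\<close> are at most
  \<open>n ^ 2\<close>.\<close>
proof (intro conjI exI[of _ sigma_program] exI[of _ "\<lambda>n. 30 * real n ^ 2"] allI impI)
  show "minimum_speed I R (sigma I R)"
    if "vehicle_route I R \<and> sigma_defined I R \<and> (\<exists>\<nu>. admissible_speed I R \<nu>) \<and> sigma I R > 0"
    for I :: "'v vrp_data" and R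
    using that minimum_speed_sigma by blast
  show "(\<lambda>n. 30 * real n ^ 2) \<in> O(\<lambda>n. real n ^ 2)"
    by simp
  fix I :: "'v vrp_data" and R
  assume R: "vehicle_route I R \<and> sigma_defined I R"
  then obtain k where k: "computes_sigma sigma_program I R k"
    "k \<le> length R * (12 * length R + 7) + 11"
    using wp_sigma_program[of I R] unfolding wp_def computes_sigma_def by blast
  have "length R \<ge> 1"
    using R by (simp add: vehicle_route_def)
  then have "length R \<le> length R ^ 2" "1 \<le> length R ^ 2"
    by (simp_all add: power2_eq_square)
  moreover have "length R * (12 * length R + 7) = 12 * length R ^ 2 + 7 * length R"
    by (simp add: power2_eq_square algebra_simps)
  ultimately have "k \<le> 30 * length R ^ 2"
    using k(2) by linarith
  then have "real k \<le> 30 * real (length R) ^ 2"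
    by (metis of_nat_le_iff of_nat_mult of_nat_numeral of_nat_power)
  then show "\<exists>k. computes_sigma sigma_program I R k \<and> real k \<le> 30 * real (length R) ^ 2"
    using k(1) by blast
qed

end
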